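(* Let $p\geq 3$ be an odd integer and let $G=(V,E)$ be a $(p,2)$-flex-connected graph with unsafe edge set $\mathcal{U}\subseteq E$. Then the family $\mathcal{F}$ of violated sets of $G$ can be written as $\mathcal{F}=\mathcal{F}_1\cup\mathcal{F}_2$ where $\mathcal{F}_1$ and $\mathcal{F}_2$ are both uncrossable families.
   Context: $G=(V,E)$ is a finite graph (parallel edges allowed) whose edge set is partitioned into safe edges and unsafe edges; $\mathcal{U}$ denotes the set of unsafe edges. For $S\subseteq V$, $\delta(S)$ is the set of edges with exactly one endpoint in $S$. $G$ is $(p,2)$-flex-connected if for every $F\subseteq\mathcal{U}$ with $|F|\leq 2$ the graph $(V,E\setminus F)$ is $p$-edge-connected. A set $S\subseteq V$ is violated if $|\delta(S)|=p+2$ and $\delta(S)$ contains at least $3$ unsafe edges. A family $\mathcal{H}\subseteq 2^V$ is uncrossable if for all $A,B\in\mathcal{H}$, either ($A\cup B\in\mathcal{H}$ and $A\cap B\in\mathcal{H}$) or ($A\setminus B\in\mathcal{H}$ and $B\setminus A\in\mathcal{H}$). *)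

theory Defs
  imports Main
begin

text \<open>
  A finite undirected multigraph without loops: edges are abstract objects in \<open>E\<close>, and \<open>ends e\<close> is
  the two-element set of endpoints of \<open>e\<close>. Parallel edges are distinct edges with the same \<open>ends\<close>.
\<close>

locale multigraph =
  fixes V :: "'v set" and E :: "'e set" and ends :: "'e \<Rightarrow> 'v set"
  assumes finite_V: "finite V"
    and finite_E: "finite E"
    and ends_subset: "e \<in> E \<Longrightarrow> ends e \<subseteq> V"
    and card_ends: "e \<in> E \<Longrightarrow> card (ends e) = 2"

definition cut :: "'e set \<Rightarrow> ('e \<Rightarrow> 'v set) \<Rightarrow> 'v set \<Rightarrow> 'e set" where
  "cut E ends S = {e \<in> E. card (ends e \<inter> S) = 1}"

definition adjacency :: "'e set \<Rightarrow> ('e \<Rightarrow> 'v set) \<Rightarrow> ('v \<times> 'v) set" where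
  "adjacency E ends = {(u, v). \<exists>e\<in>E. ends e = {u, v}}"

definition connected_graph :: "'v set \<Rightarrow> 'e set \<Rightarrow> ('e \<Rightarrow> 'v set) \<Rightarrow> bool" where
  "connected_graph V E ends \<longleftrightarrow> (\<forall>u\<in>V. \<forall>v\<in>V. (u, v) \<in> (adjacency E ends)\<^sup>*)"

text \<open>
  The graph stays connected after deleting any set of fewer than \<open>p\<close> edges. A one-vertex graph
  is \<open>p\<close>-edge-connected for every \<open>p\<close>.
\<close>

definition edge_connected :: "nat \<Rightarrow> 'v set \<Rightarrow> 'e set \<Rightarrow> ('e \<Rightarrow> 'v set) \<Rightarrow> bool" where
  "edge_connected p V E ends \<longleftrightarrow>
     (\<forall>X. X \<subseteq> E \<and> card X < p \<longrightarrow> connected_graph V (E - X) ends)"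

text \<open>\<open>U\<close> is the set of unsafe edges; the safe edges are those in \<open>E - U\<close>.\<close>

definition flex_connected ::
  "nat \<Rightarrow> nat \<Rightarrow> 'v set \<Rightarrow> 'e set \<Rightarrow> ('e \<Rightarrow> 'v set) \<Rightarrow> 'e set \<Rightarrow> bool" where
  "flex_connected p q V E ends U \<longleftrightarrow>
     (\<forall>F. F \<subseteq> U \<and> card F \<le> q \<longrightarrow> edge_connected p V (E - F) ends)"

definition violated_sets ::
  "nat \<Rightarrow> 'v set \<Rightarrow> 'e set \<Rightarrow> ('e \<Rightarrow> 'v set) \<Rightarrow> 'e set \<Rightarrow> 'v set set" where
  "violated_sets p V E ends U =
     {S. S \<subseteq> V \<and> card (cut E ends S) = p + 2 \<and> card (cut E ends S \<inter> U) \<ge> 3}"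

definition uncrossable :: "'v set set \<Rightarrow> bool" where
  "uncrossable H \<longleftrightarrow>
     (\<forall>A\<in>H. \<forall>B\<in>H. (A \<union> B \<in> H \<and> A \<inter> B \<in> H) \<or> (A - B \<in> H \<and> B - A \<in> H))"

end

theory Submission
  imports Defs
begin

text \<open>
  Write \<open>p = 2k - 1\<close>. If two violated sets \<open>A\<close>, \<open>B\<close> cross, parity and the lower bounds on cuts force their
  four corners into a square: no edge joins opposite corners, the edges of \<open>\<delta>(A)\<close> are split by \<open>B\<close>
  into \<open>k\<close> and \<open>k + 1\<close> edges, likewise those of \<open>\<delta>(B)\<close> by \<open>A\<close>, and the two parts of size \<open>k\<close>, which bound
  the same corner, contain at most one unsafe edge together. The pair can be uncrossed unless that
  one unsafe edge lies in, say, \<open>\<delta>(A)\<close> and \<open>A\<close> has exactly three unsafe edges, so that one of the two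
  corners of cut size \<open>2k + 1\<close> has only two; then \<open>A\<close> is said to be lowered by \<open>B\<close>.

  No violated set both is lowered by some set and lowers some other set. Moreover, if a crossing
  pair uncrosses to a corner that is lowered by (or lowers) \<open>C\<close>, then so is (does) one of the two
  sets themselves. Hence the violated sets that are not lowered and the violated sets that lower
  nothing are two uncrossable families covering everything.
\<close>

section \<open>Arithmetic of the square formed by two crossing violated sets\<close>

text \<open>
  Upper case letters count the edges between two of the corners \<open>P = A \<inter> B\<close>, \<open>Q = A - B\<close>, \<open>R = B - A\<close>,
  \<open>S = V - (A \<union> B)\<close>, lower case letters the unsafe ones among them.
\<close>

lemma square_arith_even:
  fixes k :: nat
  assumes a: "PR + PS + QR + QS = 2 * k + 1" "3 \<le> pr + ps + qr + qs"
    and b: "PQ + PS + QR + RS = 2 * k + 1" "3 \<le> pq + ps + qr + rs"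
    and P: "2 * k + min 2 (pq + pr + ps) \<le> PQ + PR + PS + 1"
    and Q: "2 * k + min 2 (pq + qr + qs) \<le> PQ + QR + QS + 1"
    and R: "2 * k + min 2 (pr + qr + rs) \<le> PR + QR + RS + 1"
    and S: "2 * k + min 2 (ps + qs + rs) \<le> PS + QS + RS + 1"
    and le: "ps \<le> PS" "qr \<le> QR"
    and even: "even (PQ + PR + PS)"
  shows "PS = 0 \<and> QR = 0 \<and> (PR = k \<and> PQ = k \<and> pr + pq \<le> 1 \<or> QS = k \<and> RS = k \<and> qs + rs \<le> 1)"
proof -
  obtain n where n: "PQ + PR + PS = 2 * n" using even by (rule evenE)
  have "k \<le> n" using P n by linarith
  \<comment> \<open>Both cuts together have the size of the cuts of \<open>P\<close> and
    \<open>S\<close> plus twice the edges between \<open>Q\<close> and \<open>R\<close>. So the cut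
    of \<open>S\<close> is even as well.\<close>
  have Sn: "PS + QS + RS + 2 * QR + 2 * n = 4 * k + 2" using a b n by linarith
  have "n + QR \<le> k + 1" using S Sn by linarith
  have Qn: "PQ + QR + QS + 2 * n = 2 * k + 1 + 2 * PQ" using a n by linarith
  have Rn: "PR + QR + RS + 2 * n = 2 * k + 1 + 2 * PR" using b n by linarith
  have P': "pq + pr + ps \<le> 1" if "n = k" using P n that by linarith
  have S': "ps + qs + rs \<le> 1" if "n + QR = k + 1" using S Sn that by linarith
  \<comment> \<open>Otherwise \<open>P\<close> and \<open>S\<close> both have cut size
    \<open>2 * k\<close>, hence at most one unsafe edge each, and the two cuts would count at most
    four unsafe edges instead of six.\<close>
  have "QR = 0"
  proof (rule ccontr)
    assume "QR \<noteq> 0"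
    then have "n = k" "QR = 1" using \<open>k \<le> n\<close> \<open>n + QR \<le> k + 1\<close> by auto
    then show False using P' S' a b le by linarith
  qed
  then have "qr = 0" using le by simp
  have nk: "n = k \<or> n = k + 1" using \<open>k \<le> n\<close> \<open>n + QR \<le> k + 1\<close> by linarith
  \<comment> \<open>By \<open>Qn\<close> the cut of \<open>Q\<close> is odd, so excluding the size
    \<open>2 * k - 1\<close> gives \<open>PQ \<ge> n\<close>. At that size \<open>Q\<close> would
    have no unsafe edge, and both \<open>P\<close> and \<open>S\<close> would have at least
    three.\<close>
  have Q1: "PQ + QR + QS + 1 \<noteq> 2 * k"
  proof
    assume "PQ + QR + QS + 1 = 2 * k"
    then have "pq + qr + qs = 0" using Q by linarith
    then show False using P' S' nk \<open>QR = 0\<close> a b by linarith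
  qed
  have R1: "PR + QR + RS + 1 \<noteq> 2 * k"
  proof
    assume "PR + QR + RS + 1 = 2 * k"
    then have "pr + qr + rs = 0" using R by linarith
    then show False using P' S' nk \<open>QR = 0\<close> a b by linarith
  qed
  have "PQ \<ge> n" using Q Qn Q1 by linarith
  moreover have "PR \<ge> n" using R Rn R1 by linarith
  ultimately have eq: "PQ = n" "PR = n" "PS = 0" using n by auto
  show ?thesis using nk
  proof
    assume "n = k" then show ?thesis using eq P' \<open>QR = 0\<close> by auto
  next
    assume "n = k + 1" then show ?thesis using eq S' \<open>QR = 0\<close> a b by auto
  qed
qed

text \<open>The cuts of \<open>P\<close> and \<open>Q\<close> differ in parity since \<delta>(A) is
  odd. Replacing \<open>B\<close> by its complement swaps \<open>P\<close> with \<open>Q\<close> and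
  \<open>R\<close> with \<open>S\<close>, which reduces the odd case to the even one.\<close>

lemma square_arith:
  fixes k :: nat
  assumes a: "PR + PS + QR + QS = 2 * k + 1" "3 \<le> pr + ps + qr + qs"
    and b: "PQ + PS + QR + RS = 2 * k + 1" "3 \<le> pq + ps + qr + rs"
    and P: "2 * k + min 2 (pq + pr + ps) \<le> PQ + PR + PS + 1"
    and Q: "2 * k + min 2 (pq + qr + qs) \<le> PQ + QR + QS + 1"
    and R: "2 * k + min 2 (pr + qr + rs) \<le> PR + QR + RS + 1"
    and S: "2 * k + min 2 (ps + qs + rs) \<le> PS + QS + RS + 1"
    and le: "ps \<le> PS" "qr \<le> QR"
  shows "PS = 0 \<and> QR = 0 \<and>
    (PR = k \<and> PQ = k \<and> pr + pq \<le> 1 \<or> PR = k \<and> RS = k \<and> pr + rs \<le> 1 \<or>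
     QS = k \<and> PQ = k \<and> qs + pq \<le> 1 \<or> QS = k \<and> RS = k \<and> qs + rs \<le> 1)"
proof (cases "even (PQ + PR + PS)")
  case True
  then show ?thesis using square_arith_even[OF assms] by blast
next
  case False
  have "PQ + QR + QS + (PQ + PR + PS) = 2 * k + 1 + 2 * PQ" using a by linarith
  then have "even (PQ + QS + QR)" using False by presburger
  moreover have "QS + QR + PS + PR = 2 * k + 1" "3 \<le> qs + qr + ps + pr"
      "PQ + QR + PS + RS = 2 * k + 1" "3 \<le> pq + qr + ps + rs"
      "2 * k + min 2 (pq + qs + qr) \<le> PQ + QS + QR + 1"
      "2 * k + min 2 (pq + ps + pr) \<le> PQ + PS + PR + 1"
      "2 * k + min 2 (qs + ps + rs) \<le> QS + PS + RS + 1"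
      "2 * k + min 2 (qr + pr + rs) \<le> QR + PR + RS + 1"
    using a b P Q R S by (simp_all add: add_ac)
  ultimately show ?thesis
    using square_arith_even[of QS QR PS PR k qs qr ps pr PQ RS pq rs] le by blast
qed

text \<open>The variables count the edges of a third cut inside the four corners, and the unsafe
  ones. The first disjunction says that the third set is lowered by \<open>Q\<close>; the other two
  come from its squares with \<open>A\<close> and \<open>B\<close>. If \<open>mq = k\<close> and
  \<open>mp + mq = k + 1\<close>, the extra edge must be unsafe, as the other part keeps at most one
  of the three.\<close>

lemma lowering_arith:
  fixes k :: nat
  assumes "mp + mq + mr + ms = 2 * k + 1" "up + uq + ur + us = 3"
    and "mq = k \<and> uq = 1 \<or> mp + mr + ms = k \<and> up + ur + us = 1"
    and "mp + mq = k \<and> up + uq \<le> 1 \<or> mr + ms = k \<and> ur + us \<le> 1"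
    and "mq + ms = k \<and> uq + us \<le> 1 \<or> mp + mr = k \<and> up + ur \<le> 1"
    and "up \<le> mp" "us \<le> ms"
  shows "(mp + mq = k \<and> up + uq = 1 \<or> mr + ms = k \<and> ur + us = 1) \<or>
    (mp + mr = k \<and> up + ur = 1 \<or> mq + ms = k \<and> uq + us = 1)"
  using assms by linarith

section \<open>Counting edges between vertex sets\<close>

text \<open>Here \<open>k\<close> stands for \<open>(p + 1) / 2\<close>; the last assumption is \<open>(p, 2)\<close>-flex-connectivity in terms of cuts.\<close>

locale odd_flex = multigraph V E ends
  for V :: "'v set" and E :: "'e set" and ends :: "'e \<Rightarrow> 'v set" +
  fixes U :: "'e set" and k :: nat
  assumes unsafe_subset: "U \<subseteq> E"
    and k_ge_2: "2 \<le> k"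
    and flex: "\<lbrakk>S \<subseteq> V; S \<noteq> {}; S \<noteq> V\<rbrakk> \<Longrightarrow>
      2 * k + min 2 (card (cut U ends S)) \<le> card (cut E ends S) + 1"
begin

text \<open>Unlike cut sizes, these counts are additive over disjoint unions. The edge set is a
  parameter so that the same rules serve \<open>E\<close> and \<open>U\<close>.\<close>

definition links :: "'e set \<Rightarrow> 'v set \<Rightarrow> 'v set \<Rightarrow> nat" where
  "links F X Y = card {e \<in> F. \<exists>x\<in>X. \<exists>y\<in>Y. ends e = {x, y}}"

text \<open>For \<open>p = 2 * k - 1\<close> the cut size \<open>p + 2\<close> is
  \<open>2 * k + 1\<close>.\<close>

definition violated :: "'v set \<Rightarrow> bool" where
  "violated S \<longleftrightarrow> S \<subseteq> V \<and> card (cut E ends S) = 2 * k + 1 \<and> 3 \<le> card (cut U ends S)"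

definition crosses :: "'v set \<Rightarrow> 'v set \<Rightarrow> bool" where
  "crosses A B \<longleftrightarrow> A \<inter> B \<noteq> {} \<and> A - B \<noteq> {} \<and> B - A \<noteq> {} \<and> V - (A \<union> B) \<noteq> {}"

text \<open>
  The set \<open>D\<close> selects the side of \<open>C\<close> on which \<open>\<delta>(A)\<close> has only \<open>k\<close> edges.
\<close>

definition lowered_by :: "'v set \<Rightarrow> 'v set \<Rightarrow> bool" where
  "lowered_by A C \<longleftrightarrow> violated A \<and> violated C \<and> crosses A C \<and> card (cut U ends A) = 3 \<and>
     (\<exists>D\<in>{C, V - C}. links E (A \<inter> D) (D - A) = k \<and> links U (A \<inter> D) (D - A) = 1)"

text \<open>Cells may be empty, and positions matter: in \<open>[P, Q, R, S]\<close> the two sets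
  under study are \<open>P \<union> Q\<close> and \<open>P \<union> R\<close>. On explicit lists
  \<open>sorted_wrt disjnt\<close> unfolds to pairwise disjointness.\<close>

definition cells :: "'v set list \<Rightarrow> bool" where
  "cells Qs \<longleftrightarrow> \<Union> (set Qs) = V \<and> sorted_wrt disjnt Qs"

lemma finite_U: "finite U"
  using unsafe_subset finite_E by (rule finite_subset)

lemma links_commute: "links F X Y = links F Y X"
  unfolding links_def by (rule arg_cong[where f=card]) (auto simp: insert_commute)

lemma links_empty [simp]: "links F {} Y = 0" "links F X {} = 0"
  by (simp_all add: links_def)

lemma links_Un_left:
  assumes "F = E \<or> F = U" "disjnt X Y" "disjnt X Z" "disjnt Y Z"
  shows "links F (X \<union> Y) Z = links F X Z + links F Y Z"
proof -
  have "finite F" using assms(1) finite_E finite_U by auto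
  have "{e \<in> F. \<exists>x\<in>X \<union> Y. \<exists>z\<in>Z. ends e = {x, z}} =
      {e \<in> F. \<exists>x\<in>X. \<exists>z\<in>Z. ends e = {x, z}} \<union> {e \<in> F. \<exists>x\<in>Y. \<exists>z\<in>Z. ends e = {x, z}}"
    by auto
  moreover have "{e \<in> F. \<exists>x\<in>X. \<exists>z\<in>Z. ends e = {x, z}} \<inter> {e \<in> F. \<exists>x\<in>Y. \<exists>z\<in>Z. ends e = {x, z}} = {}"
    using assms(2-4) by (auto simp: disjnt_iff doubleton_eq_iff)
  ultimately show ?thesis
    unfolding links_def using \<open>finite F\<close> by (simp add: card_Un_disjoint)
qed

lemma links_Un_right:
  assumes "F = E \<or> F = U" "disjnt X Y" "disjnt X Z" "disjnt Y Z"
  shows "links F Z (X \<union> Y) = links F Z X + links F Z Y"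
  using links_Un_left[OF assms] by (simp add: links_commute)

lemma links_le: "links U X Y \<le> links E X Y"
  unfolding links_def using unsafe_subset finite_E by (intro card_mono) auto

lemma card_cut:
  assumes "F = E \<or> F = U" "X \<union> Y = V" "disjnt X Y"
  shows "card (cut F ends X) = links F X Y"
proof -
  have "card (ends e \<inter> X) = 1 \<longleftrightarrow> (\<exists>x\<in>X. \<exists>y\<in>Y. ends e = {x, y})" if "e \<in> F" for e
  proof -
    have "e \<in> E" using that assms(1) unsafe_subset by auto
    then obtain a b where ab: "ends e = {a, b}" "a \<noteq> b"
      using card_ends by (meson card_2_iff)
    then have "a \<in> X \<union> Y" "b \<in> X \<union> Y" using ends_subset[OF \<open>e \<in> E\<close>] assms(2) by auto
    then show ?thesis using ab assms(3)
      by (cases "a \<in> X"; cases "b \<in> X") (auto simp: disjnt_iff doubleton_eq_iff)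
  qed
  then show ?thesis unfolding links_def cut_def by (intro arg_cong[where f=card]) blast
qed

lemma violated_iff:
  assumes "X \<union> Y = V" "disjnt X Y"
  shows "violated X \<longleftrightarrow> links E X Y = 2 * k + 1 \<and> 3 \<le> links U X Y"
    and "violated Y \<longleftrightarrow> violated X"
  using card_cut[of E X Y] card_cut[of U X Y] card_cut[of E Y X] card_cut[of U Y X] assms
  by (auto simp: violated_def links_commute[of _ Y X] disjnt_sym Un_commute)

lemma flex_links:
  assumes "X \<union> Y = V" "disjnt X Y" "X \<noteq> {}" "Y \<noteq> {}"
  shows "2 * k + min 2 (links U X Y) \<le> links E X Y + 1"
proof -
  have "X \<noteq> V" using assms by (auto simp: disjnt_iff)
  then show ?thesis
    using flex[of X] card_cut[of E X Y] card_cut[of U X Y] assms by auto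
qed

section \<open>The square of two crossing violated sets\<close>

text \<open>Expanding all cuts into counts between corners reduces this to
  \<open>square_arith\<close>. Conclusions are cited by position below: 1 to 4 concern opposite
  corners, 5 and 6 sizes, 7 to 10 unsafe edges, and 11 locates the corner with two short
  sides.\<close>

lemma square_cells:
  assumes c: "cells [P, Q, R, S]"
    and ne: "P \<noteq> {}" "Q \<noteq> {}" "R \<noteq> {}" "S \<noteq> {}"
    and v: "violated (P \<union> Q)" "violated (P \<union> R)"
  shows "links E P S = 0" "links E Q R = 0" "links U P S = 0" "links U Q R = 0"
    and "links E P R + links E Q S = 2 * k + 1"
    and "links E P Q + links E R S = 2 * k + 1"
    and "card (cut U ends (P \<union> Q)) = links U P R + links U Q S"
    and "card (cut U ends (P \<union> R)) = links U P Q + links U R S"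
    and "3 \<le> links U P R + links U Q S"
    and "3 \<le> links U P Q + links U R S"
    and "links E P R = k \<and> links E P Q = k \<and> links U P R + links U P Q \<le> 1 \<or>
         links E P R = k \<and> links E R S = k \<and> links U P R + links U R S \<le> 1 \<or>
         links E Q S = k \<and> links E P Q = k \<and> links U Q S + links U P Q \<le> 1 \<or>
         links E Q S = k \<and> links E R S = k \<and> links U Q S + links U R S \<le> 1"
proof -
  have dj: "disjnt P Q" "disjnt P R" "disjnt P S" "disjnt Q R" "disjnt Q S" "disjnt R S"
    "disjnt Q P" "disjnt R P" "disjnt S P" "disjnt R Q" "disjnt S Q" "disjnt S R"
    using c by (auto simp: cells_def disjnt_sym)
  have V: "V = P \<union> Q \<union> R \<union> S" using c by (auto simp: cells_def)
  note split = links_Un_left links_Un_right dj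
  note comm = links_commute[of _ Q P] links_commute[of _ R P] links_commute[of _ S P]
     links_commute[of _ R Q] links_commute[of _ S Q] links_commute[of _ S R]
  have A: "links F (P \<union> Q) (R \<union> S) = links F P R + links F P S + links F Q R + links F Q S"
    and B: "links F (P \<union> R) (Q \<union> S) = links F P Q + links F P S + links F Q R + links F R S"
    and 1: "links F P (Q \<union> R \<union> S) = links F P Q + links F P R + links F P S"
    and 2: "links F Q (P \<union> R \<union> S) = links F P Q + links F Q R + links F Q S"
    and 3: "links F R (P \<union> Q \<union> S) = links F P R + links F Q R + links F R S"
    and 4: "links F S (P \<union> Q \<union> R) = links F P S + links F Q S + links F R S"
    if "F = E \<or> F = U" for F
    using that by (simp_all add: split comm)
  have a: "links E P R + links E P S + links E Q R + links E Q S = 2 * k + 1"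
       "3 \<le> links U P R + links U P S + links U Q R + links U Q S"
    using violated_iff(1)[of "P \<union> Q" "R \<union> S"] v(1) V dj A by auto
  have b: "links E P Q + links E P S + links E Q R + links E R S = 2 * k + 1"
       "3 \<le> links U P Q + links U P S + links U Q R + links U R S"
    using violated_iff(1)[of "P \<union> R" "Q \<union> S"] v(2) V dj B by auto
  have fP: "2 * k + min 2 (links U P Q + links U P R + links U P S) \<le> links E P Q + links E P R + links E P S + 1"
    using flex_links[of P "Q \<union> R \<union> S"] V dj ne 1 by auto
  have fQ: "2 * k + min 2 (links U P Q + links U Q R + links U Q S) \<le> links E P Q + links E Q R + links E Q S + 1"
    using flex_links[of Q "P \<union> R \<union> S"] V dj ne 2 by auto
  have fR: "2 * k + min 2 (links U P R + links U Q R + links U R S) \<le> links E P R + links E Q R + links E R S + 1"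
    using flex_links[of R "P \<union> Q \<union> S"] V dj ne 3 by auto
  have fS: "2 * k + min 2 (links U P S + links U Q S + links U R S) \<le> links E P S + links E Q S + links E R S + 1"
    using flex_links[of S "P \<union> Q \<union> R"] V dj ne 4 by auto
  have Z: "links E P S = 0 \<and> links E Q R = 0 \<and>
    (links E P R = k \<and> links E P Q = k \<and> links U P R + links U P Q \<le> 1 \<or>
     links E P R = k \<and> links E R S = k \<and> links U P R + links U R S \<le> 1 \<or>
     links E Q S = k \<and> links E P Q = k \<and> links U Q S + links U P Q \<le> 1 \<or>
     links E Q S = k \<and> links E R S = k \<and> links U Q S + links U R S \<le> 1)"
    by (rule square_arith[OF a b fP fQ fR fS links_le links_le])
  then have z: "links E P S = 0" "links E Q R = 0" "links U P S = 0" "links U Q R = 0"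
    using links_le[of P S] links_le[of Q R] by auto
  show "links E P S = 0" "links E Q R = 0" "links U P S = 0" "links U Q R = 0" by (fact z)+
  show "links E P R + links E Q S = 2 * k + 1" "links E P Q + links E R S = 2 * k + 1"
       "3 \<le> links U P R + links U Q S" "3 \<le> links U P Q + links U R S"
    using a b z by auto
  show "card (cut U ends (P \<union> Q)) = links U P R + links U Q S"
    using card_cut[of U "P \<union> Q" "R \<union> S"] A[of U] V dj z by auto
  show "card (cut U ends (P \<union> R)) = links U P Q + links U R S"
    using card_cut[of U "P \<union> R" "Q \<union> S"] B[of U] V dj z by auto
  show "links E P R = k \<and> links E P Q = k \<and> links U P R + links U P Q \<le> 1 \<or>
     links E P R = k \<and> links E R S = k \<and> links U P R + links U R S \<le> 1 \<or>
     links E Q S = k \<and> links E P Q = k \<and> links U Q S + links U P Q \<le> 1 \<or>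
     links E Q S = k \<and> links E R S = k \<and> links U Q S + links U R S \<le> 1"
    using Z by blast
qed

section \<open>The lowering relation in terms of cells and under complement\<close>

text \<open>The choice \<open>D = C\<close> becomes the pair \<open>P\<close>, \<open>R\<close>, and
  \<open>D = V - C\<close> the pair \<open>Q\<close>, \<open>S\<close>.\<close>

lemma lowered_by_iff:
  assumes "cells [P, Q, R, S]" "A = P \<union> Q" "C = P \<union> R"
  shows "lowered_by A C \<longleftrightarrow> violated A \<and> violated C \<and> P \<noteq> {} \<and> Q \<noteq> {} \<and> R \<noteq> {} \<and> S \<noteq> {} \<and>
     card (cut U ends A) = 3 \<and>
     (links E P R = k \<and> links U P R = 1 \<or> links E Q S = k \<and> links U Q S = 1)"
proof -
  have dj: "P \<inter> Q = {}" "P \<inter> R = {}" "P \<inter> S = {}" "Q \<inter> R = {}" "Q \<inter> S = {}" "R \<inter> S = {}"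
    and V: "V = P \<union> Q \<union> R \<union> S"
    using assms(1) by (auto simp: cells_def disjnt_def)
  have "A \<inter> C = P" "A - C = Q" "C - A = R" "V - (A \<union> C) = S" "A \<inter> (V - C) = Q" "V - C - A = S"
    using dj V unfolding assms(2,3) by blast+
  then show ?thesis unfolding lowered_by_def crosses_def by simp
qed

lemma cells4: "A \<subseteq> V \<Longrightarrow> C \<subseteq> V \<Longrightarrow> cells [A \<inter> C, A - C, C - A, V - (A \<union> C)]"
  by (auto simp: cells_def disjnt_def)

lemma lowered_by_subset: "lowered_by A C \<Longrightarrow> A \<subseteq> V \<and> C \<subseteq> V"
  by (auto simp: lowered_by_def violated_def)

lemma violated_Compl: "S \<subseteq> V \<Longrightarrow> violated (V - S) \<longleftrightarrow> violated S"
  using violated_iff(2)[of S "V - S"] by (auto simp: disjnt_def)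

text \<open>Complementing \<open>C\<close> only exchanges the two candidates for \<open>D\<close>,
  so later proofs may take the selected side itself as the lowering set.\<close>

lemma lowered_by_Compl_right:
  assumes "C \<subseteq> V"
  shows "lowered_by A (V - C) \<longleftrightarrow> lowered_by A C"
proof (cases "A \<subseteq> V")
  case True
  then have "crosses A (V - C) \<longleftrightarrow> crosses A C" "V - (V - C) = C"
    using assms by (auto simp: crosses_def)
  then show ?thesis unfolding lowered_by_def using violated_Compl assms by auto
qed (use lowered_by_subset in blast)

text \<open>Complementing \<open>A\<close> exchanges \<open>A \<inter> D\<close> with
  \<open>D - A\<close>, and the counts are symmetric.\<close>

lemma lowered_by_Compl_left:
  assumes "A \<subseteq> V"
  shows "lowered_by (V - A) C \<longleftrightarrow> lowered_by A C"
proof (cases "C \<subseteq> V")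
  case True
  then have 1: "crosses (V - A) C \<longleftrightarrow> crosses A C"
    using assms by (auto simp: crosses_def)
  have 2: "card (cut U ends (V - A)) = card (cut U ends A)"
    using card_cut[of U A "V - A"] card_cut[of U "V - A" A] assms
    by (simp add: links_commute Un_absorb1 Un_absorb2 disjnt_def Int_Diff Int_commute)
  have 3: "(V - A) \<inter> D = D - A" "D - (V - A) = A \<inter> D" if "D \<in> {C, V - C}" for D
    using that assms True by auto
  show ?thesis
    unfolding lowered_by_def 1 2 using violated_Compl[OF assms] 3 by (simp add: links_commute)
qed (use lowered_by_subset in blast)

lemma small_square:
  assumes "cells [P, Q, R, S]" "P \<noteq> {}" "Q \<noteq> {}" "R \<noteq> {}" "S \<noteq> {}"
    and "violated (P \<union> Q)" "violated (P \<union> R)"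
    and "links E P Q = k" "links E P R = k"
  shows "links E Q S = k + 1" "links E R S = k + 1" "links U P R + links U P Q \<le> 1"
  using square_cells[OF assms(1-7)] assms(8,9) by auto

section \<open>Three sets and their eight cells\<close>

text \<open>
  Three sets cut \<open>V\<close> into eight cells: the indices 1 and 2 mark the two sides of the third set within
  the corners \<open>P\<close>, \<open>Q\<close>, \<open>R\<close>, \<open>S\<close> of the first two.
\<close>

context
  fixes p1 p2 q1 q2 r1 r2 s1 s2
  assumes cells8: "cells [p1, p2, q1, q2, r1, r2, s1, s2]"
begin

lemma disjoint8:
  "sorted_wrt disjnt [p1, p2, q1, q2, r1, r2, s1, s2]"
  "sorted_wrt disjnt [s2, s1, r2, r1, q2, q1, p2, p1]"
  using cells8 by (auto simp: cells_def disjnt_sym)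

lemma union8: "p1 \<union> (p2 \<union> (q1 \<union> (q2 \<union> (r1 \<union> (r2 \<union> (s1 \<union> s2)))))) = V"
  using cells8 by (simp add: cells_def)

lemmas disj8 = disjoint8[simplified]
text \<open>\<open>simplified expand8\<close> rewrites with exactly these rules, hence the entry
  \<open>simp_thms\<close>. It breaks counts into counts between single cells, and
  \<open>add_is_0\<close> splits vanishing sums.\<close>

lemmas expand8 = links_Un_left links_Un_right links_commute disj8 simp_thms disjnt_Un1 disjnt_Un2
  add_is_0

text \<open>With \<open>D\<close> the union of the cells of index 1, these are the squares of
  \<open>A\<close> and \<open>B\<close>, then of \<open>Q\<close> and \<open>D\<close>,
  \<open>A\<close> and \<open>D\<close>, \<open>B\<close> and \<open>D\<close>, each of the last
  three in both orders.\<close>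

lemma merge8:
  "cells [p1 \<union> p2, q1 \<union> q2, r1 \<union> r2, s1 \<union> s2]"
  "cells [q1, q2, p1 \<union> r1 \<union> s1, p2 \<union> r2 \<union> s2]"
  "cells [q1, p1 \<union> r1 \<union> s1, q2, p2 \<union> r2 \<union> s2]"
  "cells [p1 \<union> q1, p2 \<union> q2, r1 \<union> s1, r2 \<union> s2]"
  "cells [p1 \<union> q1, r1 \<union> s1, p2 \<union> q2, r2 \<union> s2]"
  "cells [p1 \<union> r1, p2 \<union> r2, q1 \<union> s1, q2 \<union> s2]"
  "cells [p1 \<union> r1, q1 \<union> s1, p2 \<union> r2, q2 \<union> s2]"
  by (simp_all add: cells_def disj8 union8 Un_ac)

text \<open>All three unsafe edges of \<delta>(Q) lead to \<open>S\<close>, exactly one of them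
  inside \<open>D\<close>. This makes \<open>A\<close> and \<open>D\<close> cross, and the bounds on
  the two halves of \<open>P\<close> then leave only \<open>k = 2\<close>, where the needed counts
  are determined.\<close>

lemma lowered_of_corner8:
  assumes ne: "p1 \<union> p2 \<noteq> {}" "q1 \<union> q2 \<noteq> {}" "r1 \<union> r2 \<noteq> {}" "s1 \<union> s2 \<noteq> {}"
    and v: "violated (p1 \<union> p2 \<union> (q1 \<union> q2))" "violated (p1 \<union> p2 \<union> (r1 \<union> r2))"
    and small: "links E (p1 \<union> p2) (q1 \<union> q2) = k" "links E (p1 \<union> p2) (r1 \<union> r2) = k"
    and low: "lowered_by (q1 \<union> q2) (q1 \<union> (p1 \<union> r1 \<union> s1))"
    and D: "links E q1 (p1 \<union> r1 \<union> s1) = k" "links U q1 (p1 \<union> r1 \<union> s1) = 1"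
  shows "lowered_by (p1 \<union> p2 \<union> (q1 \<union> q2)) (q1 \<union> (p1 \<union> r1 \<union> s1))"
proof -
  have vD: "violated (q1 \<union> q2)" "violated (q1 \<union> (p1 \<union> r1 \<union> s1))"
   and ne': "q1 \<noteq> {}" "q2 \<noteq> {}" "p1 \<union> r1 \<union> s1 \<noteq> {}" "p2 \<union> r2 \<union> s2 \<noteq> {}"
   and u3: "card (cut U ends (q1 \<union> q2)) = 3"
    using low unfolding lowered_by_iff[OF merge8(2) refl refl] by auto
  note sq = square_cells[OF merge8(1) ne v] small_square[OF merge8(1) ne v small]
  note sqQ = square_cells[OF merge8(2) ne' vD]
  note z = sq(1-4)[simplified expand8] sqQ(1-4)[simplified expand8]
  note sq' = sq[simplified expand8 z add_0_left add_0_right]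
  note sqQ' = sqQ[simplified expand8 z add_0_left add_0_right]
  note D' = D[simplified expand8 z add_0_left add_0_right]
  \<comment> \<open>At most one unsafe edge joins \<open>P\<close> to \<open>Q\<close> or
    \<open>R\<close>, and \<delta>(A) has at least three. As \<delta>(Q) has just three, none of
    them goes to \<open>P\<close>.\<close>
  have pq: "links U p1 q1 + links U p2 q2 = 0"
    using sq'(9,14) sqQ'(7) u3 z by simp
  have qs: "links U q1 s1 = 1" "links U q2 s2 = 2"
    using pq sqQ'(7) u3 D'(2) z by simp_all
  have E1: "1 \<le> links E q1 s1" "2 \<le> links E q2 s2"
    using links_le[of q1 s1] links_le[of q2 s2] qs by simp_all
  have Epq: "links E p1 q1 + links E q1 s1 = k" "links E p1 q1 + links E p2 q2 = k"
      "links E q1 s1 + links E q2 s2 = k + 1"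
    using D'(1) small[simplified expand8] sq'(12) z by simp_all
  have E2: "1 \<le> links E p1 q1" "1 \<le> links E p2 q2"
    using Epq E1 by linarith+
  have ne1: "p1 \<noteq> {}" "p2 \<noteq> {}" "s1 \<noteq> {}" "s2 \<noteq> {}" using E1 E2 by auto
  have vA: "violated ((p1 \<union> q1) \<union> (p2 \<union> q2))" "violated ((p1 \<union> q1) \<union> (r1 \<union> s1))"
    using v(1) vD(2) by (simp_all add: Un_ac)
  have neA: "p1 \<union> q1 \<noteq> {}" "p2 \<union> q2 \<noteq> {}" "r1 \<union> s1 \<noteq> {}" "r2 \<union> s2 \<noteq> {}"
    using ne1 by auto
  note sqA = square_cells[OF merge8(4) neA vA]
  note zA = sqA(1-4)[simplified expand8]
  note sqA' = sqA[simplified expand8 z zA add_0_left add_0_right]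
  have P: "links E p1 r1 + links E p2 r2 = k" using small(2)[simplified expand8] zA by simp
  \<comment> \<open>At most \<open>k + 1\<close> edges of \<delta>(D) lie inside \<open>A\<close>,
    and at least \<open>k\<close> of these inside \<open>Q\<close>, so at most one joins
    \<open>p1\<close> to \<open>p2\<close>.\<close>
  have c1: "links E p1 p2 + links E q1 q2 \<le> k + 1" "k \<le> links E q1 q2"
    using sqA'(6,11) sqQ'(6,11) by auto
  have f1: "2 * k + min 2 (links U p1 p2 + links U p1 q1 + links U p1 r1)
      \<le> links E p1 p2 + links E p1 q1 + links E p1 r1 + 1"
    using flex_links[of p1 "p2 \<union> q1 \<union> q2 \<union> r1 \<union> r2 \<union> s1 \<union> s2"] ne1 disj8 union8
    by (simp add: expand8 z zA Un_ac)
  have f2: "2 * k + min 2 (links U p1 p2 + links U p2 q2 + links U p2 r2)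
      \<le> links E p1 p2 + links E p2 q2 + links E p2 r2 + 1"
    using flex_links[of p2 "p1 \<union> q1 \<union> q2 \<union> r1 \<union> r2 \<union> s1 \<union> s2"] ne1 disj8 union8
    by (simp add: expand8 z zA Un_ac)
  \<comment> \<open>The corner \<open>P\<close> has cut size \<open>2k\<close>, and splitting it along \<open>D\<close> costs too much unless \<open>k = 2\<close>.\<close>
  have k2: "k = 2" "links E p1 p2 = 1" using f1 f2 P Epq c1 k_ge_2 by linarith+
  then have p: "links E p1 q1 = 1" "links E p2 q2 = 1" "links E q1 s1 = 1"
    using Epq E2 by linarith+
  \<comment> \<open>Both bounds are now tight, so no unsafe edge joins \<open>P\<close> to
    \<open>R\<close>, and \<delta>(A) has only the three between \<open>Q\<close> and
    \<open>S\<close>.\<close>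
  then have "links E p1 r1 = 1" "links U p1 r1 = 0" "links U p2 r2 = 0"
    using f1 f2 P k2 by linarith+
  then have "links E (p1 \<union> q1) (r1 \<union> s1) = k" "links U (p1 \<union> q1) (r1 \<union> s1) = 1"
     "card (cut U ends ((p1 \<union> q1) \<union> (p2 \<union> q2))) = 3"
    using p k2 qs sqA'(7) by (simp_all add: expand8 z zA)
  then have "lowered_by ((p1 \<union> q1) \<union> (p2 \<union> q2)) ((p1 \<union> q1) \<union> (r1 \<union> s1))"
    unfolding lowered_by_iff[OF merge8(4) refl refl] using vA neA by blast
  then show ?thesis by (simp add: Un_ac)
qed

text \<open>If the third set crosses both \<open>A\<close> and \<open>B\<close>,
  \<open>lowering_arith\<close> applies. If it fails to cross one of them, two corners contain no
  edge of its cut, and the other set splits that cut just as \<open>Q\<close> does.\<close>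

lemma lowering_of_corner8:
  assumes ne: "p1 \<union> p2 \<noteq> {}" "q1 \<union> q2 \<noteq> {}" "r1 \<union> r2 \<noteq> {}" "s1 \<union> s2 \<noteq> {}"
    and v: "violated (p1 \<union> p2 \<union> (q1 \<union> q2))" "violated (p1 \<union> p2 \<union> (r1 \<union> r2))"
    and low: "lowered_by (q1 \<union> (p1 \<union> r1 \<union> s1)) (q1 \<union> q2)"
  shows "lowered_by (q1 \<union> (p1 \<union> r1 \<union> s1)) (p1 \<union> p2 \<union> (q1 \<union> q2)) \<or>
         lowered_by (q1 \<union> (p1 \<union> r1 \<union> s1)) (p1 \<union> p2 \<union> (r1 \<union> r2))"
proof -
  let ?D = "q1 \<union> (p1 \<union> r1 \<union> s1)"
  have vD: "violated (q1 \<union> q2)" "violated ?D"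
   and ne': "q1 \<noteq> {}" "q2 \<noteq> {}" "p1 \<union> r1 \<union> s1 \<noteq> {}" "p2 \<union> r2 \<union> s2 \<noteq> {}"
   and u3: "card (cut U ends ?D) = 3"
   and part: "links E q1 q2 = k \<and> links U q1 q2 = 1 \<or>
     links E (p1 \<union> r1 \<union> s1) (p2 \<union> r2 \<union> s2) = k \<and> links U (p1 \<union> r1 \<union> s1) (p2 \<union> r2 \<union> s2) = 1"
    using low unfolding lowered_by_iff[OF merge8(3) refl refl] by auto
  note sq = square_cells[OF merge8(1) ne v]
  note sqQ = square_cells[OF merge8(2) ne' vD]
  note z = sq(1-4)[simplified expand8] sqQ(1-4)[simplified expand8]
  note sqQ' = sqQ(6,8)[simplified expand8 z add_0_left add_0_right]
  note part' = part[simplified expand8 z add_0_left add_0_right]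
  have vA: "violated ((p1 \<union> q1) \<union> (p2 \<union> q2))" "violated ((p1 \<union> q1) \<union> (r1 \<union> s1))"
    and vB: "violated ((p1 \<union> r1) \<union> (p2 \<union> r2))" "violated ((p1 \<union> r1) \<union> (q1 \<union> s1))"
    and card3: "card (cut U ends ((p1 \<union> q1) \<union> (r1 \<union> s1))) = 3" "card (cut U ends ((p1 \<union> r1) \<union> (q1 \<union> s1))) = 3"
    using v vD(2) u3 by (simp_all add: Un_ac)
  have crossA: "lowered_by ?D (p1 \<union> p2 \<union> (q1 \<union> q2))"
    if "r1 \<union> s1 \<noteq> {}" "r2 \<union> s2 \<noteq> {}"
      "links E (p1 \<union> q1) (p2 \<union> q2) = k \<and> links U (p1 \<union> q1) (p2 \<union> q2) = 1 \<or>
       links E (r1 \<union> s1) (r2 \<union> s2) = k \<and> links U (r1 \<union> s1) (r2 \<union> s2) = 1"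
  proof -
    have "lowered_by ((p1 \<union> q1) \<union> (r1 \<union> s1)) ((p1 \<union> q1) \<union> (p2 \<union> q2))"
      unfolding lowered_by_iff[OF merge8(5) refl refl] using that vA card3 ne' by blast
    then show ?thesis by (simp add: Un_ac)
  qed
  have crossB: "lowered_by ?D (p1 \<union> p2 \<union> (r1 \<union> r2))"
    if "p1 \<union> r1 \<noteq> {}" "p2 \<union> r2 \<noteq> {}"
      "links E (p1 \<union> r1) (p2 \<union> r2) = k \<and> links U (p1 \<union> r1) (p2 \<union> r2) = 1 \<or>
       links E (q1 \<union> s1) (q2 \<union> s2) = k \<and> links U (q1 \<union> s1) (q2 \<union> s2) = 1"
  proof -
    have "lowered_by ((p1 \<union> r1) \<union> (q1 \<union> s1)) ((p1 \<union> r1) \<union> (p2 \<union> r2))"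
      unfolding lowered_by_iff[OF merge8(7) refl refl] using that vB card3 ne' by blast
    then show ?thesis by (simp add: Un_ac)
  qed
  \<comment> \<open>Two failures at once would leave \<open>R\<close>, \<open>?D - Q\<close> or
    \<open>V - (?D \<union> Q)\<close> empty.\<close>
  consider (B) "p1 \<union> r1 = {} \<or> p2 \<union> r2 = {}" "r1 \<union> s1 \<noteq> {}" "r2 \<union> s2 \<noteq> {}"
    | (A) "r1 \<union> s1 = {} \<or> r2 \<union> s2 = {}" "p1 \<union> r1 \<noteq> {}" "p2 \<union> r2 \<noteq> {}"
    | (AB) "p1 \<union> r1 \<noteq> {}" "p2 \<union> r2 \<noteq> {}" "r1 \<union> s1 \<noteq> {}" "r2 \<union> s2 \<noteq> {}"
    using ne ne' by blast
  then show ?thesis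
  proof cases
    case B
    have "lowered_by ?D (p1 \<union> p2 \<union> (q1 \<union> q2))"
      using B(1) part' by (intro crossA B(2,3)) (auto simp: expand8 z)
    then show ?thesis ..
  next
    case A
    have "lowered_by ?D (p1 \<union> p2 \<union> (r1 \<union> r2))"
      using A(1) part' by (intro crossB A(2,3)) (auto simp: expand8 z)
    then show ?thesis ..
  next
    case AB
    have neA: "p1 \<union> q1 \<noteq> {}" "p2 \<union> q2 \<noteq> {}" "q1 \<union> s1 \<noteq> {}" "q2 \<union> s2 \<noteq> {}" using ne' by auto
    note sqA = square_cells[OF merge8(4) neA(1,2) AB(3,4) vA]
    note sqB = square_cells[OF merge8(6) AB(1,2) neA(3,4) vB]
    note zz = z sqA(1-4)[simplified expand8] sqB(1-4)[simplified expand8]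
    have "(links E p1 p2 + links E q1 q2 = k \<and> links U p1 p2 + links U q1 q2 = 1 \<or>
           links E r1 r2 + links E s1 s2 = k \<and> links U r1 r2 + links U s1 s2 = 1) \<or>
          (links E p1 p2 + links E r1 r2 = k \<and> links U p1 p2 + links U r1 r2 = 1 \<or>
           links E q1 q2 + links E s1 s2 = k \<and> links U q1 q2 + links U s1 s2 = 1)"
    proof (rule lowering_arith)
      show "links E p1 p2 + links E q1 q2 + links E r1 r2 + links E s1 s2 = 2 * k + 1"
        using sqA(6) by (simp add: expand8 zz)
      show "links U p1 p2 + links U q1 q2 + links U r1 r2 + links U s1 s2 = 3"
        using sqA(8) card3 by (simp add: expand8 zz)
      show "links E q1 q2 = k \<and> links U q1 q2 = 1 \<or>
        links E p1 p2 + links E r1 r2 + links E s1 s2 = k \<and>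
        links U p1 p2 + links U r1 r2 + links U s1 s2 = 1"
        using part by (simp add: expand8 zz)
      show "links E p1 p2 + links E q1 q2 = k \<and> links U p1 p2 + links U q1 q2 \<le> 1 \<or>
           links E r1 r2 + links E s1 s2 = k \<and> links U r1 r2 + links U s1 s2 \<le> 1"
        using sqA(11) by (auto simp: expand8 zz)
      show "links E q1 q2 + links E s1 s2 = k \<and> links U q1 q2 + links U s1 s2 \<le> 1 \<or>
        links E p1 p2 + links E r1 r2 = k \<and> links U p1 p2 + links U r1 r2 \<le> 1"
        using sqB(11) by (auto simp: expand8 zz)
    qed (rule links_le)+
    then show ?thesis using crossA[OF AB(3,4)] crossB[OF AB(1,2)] by (simp add: expand8 zz) blast
  qed
qed

text \<open>All unsafe edges of \<delta>(A) lie outside \<open>C\<close>, which forces all eight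
  cells to be nonempty. Any two of the three sets then form a square, so edges run only along the
  sides of a cube, and the bounds at its eight corners leave no unsafe edge for \<delta>(B).\<close>

lemma lowering_not_lowered8:
  assumes A_def: "A = p1 \<union> p2 \<union> (q1 \<union> q2)" and B_def: "B = p1 \<union> p2 \<union> (r1 \<union> r2)"
    and C_def: "C = (p1 \<union> q1) \<union> (r1 \<union> s1)"
    and low: "lowered_by A B" "lowered_by C A"
    and part: "links E (p1 \<union> p2) (r1 \<union> r2) = k" "links U (p1 \<union> p2) (r1 \<union> r2) = 1"
    and partC: "links E (p1 \<union> q1) (r1 \<union> s1) = k"
  shows False
proof -
  have A': "A = (p1 \<union> q1) \<union> (p2 \<union> q2)" unfolding A_def by (simp add: Un_ac)
  have ne: "p1 \<union> p2 \<noteq> {}" "q1 \<union> q2 \<noteq> {}" "r1 \<union> r2 \<noteq> {}" "s1 \<union> s2 \<noteq> {}"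
    and v: "violated A" "violated B" and uA: "card (cut U ends A) = 3"
    using low(1) unfolding lowered_by_iff[OF merge8(1) A_def B_def] by auto
  have neC: "p1 \<union> q1 \<noteq> {}" "p2 \<union> q2 \<noteq> {}" "r1 \<union> s1 \<noteq> {}" "r2 \<union> s2 \<noteq> {}"
    and vC: "violated C" and uC: "card (cut U ends C) = 3"
    and down: "links E (p1 \<union> q1) (p2 \<union> q2) = k \<and> links U (p1 \<union> q1) (p2 \<union> q2) = 1 \<or>
     links E (r1 \<union> s1) (r2 \<union> s2) = k \<and> links U (r1 \<union> s1) (r2 \<union> s2) = 1"
    using low(2) unfolding lowered_by_iff[OF merge8(5) C_def A'] by auto
  note sq = square_cells[OF merge8(1) ne v[unfolded A_def B_def]]
  note sqC = square_cells[OF merge8(4) neC v(1)[unfolded A'] vC[unfolded C_def]]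
  note z = sq(1-4)[simplified expand8] sqC(1-4)[simplified expand8]
  \<comment> \<open>The short parts of \<delta>(A) and \<delta>(C) hold at most one unsafe edge
    together, and that of \<delta>(C) has it because \<open>C\<close> is lowered by
    \<open>A\<close>.\<close>
  have "links U (p1 \<union> q1) (r1 \<union> s1) = 0"
    using sqC(5-8,11) down partC uC by (auto simp: C_def)
  then have z': "links U p1 r1 = 0" "links U q1 s1 = 0" by (simp_all add: expand8)
  have u: "links U p2 r2 = 1" "links U q2 s2 = 2"
    using part(2) z' sq(7) uA by (simp_all add: expand8 z A_def)
  have e: "links E p1 r1 + links E p2 r2 = k" "links E q1 s1 + links E q2 s2 = k + 1"
     "links E p1 r1 + links E q1 s1 = k"
    using part partC sq(5) by (simp_all add: expand8 z)
  have e1: "1 \<le> links E p2 r2" "2 \<le> links E q2 s2"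
    using links_le[of p2 r2] links_le[of q2 s2] u by simp_all
  then have e2: "1 \<le> links E q1 s1" "1 \<le> links E p1 r1" using e by linarith+
  have ne8: "p1 \<noteq> {}" "p2 \<noteq> {}" "q1 \<noteq> {}" "q2 \<noteq> {}" "r1 \<noteq> {}" "r2 \<noteq> {}" "s1 \<noteq> {}" "s2 \<noteq> {}"
    using e1 e2 by auto
  have neB: "p1 \<union> r1 \<noteq> {}" "p2 \<union> r2 \<noteq> {}" "q1 \<union> s1 \<noteq> {}" "q2 \<union> s2 \<noteq> {}"
    using ne8 by auto
  have vB: "violated ((p1 \<union> r1) \<union> (p2 \<union> r2))" "violated ((p1 \<union> r1) \<union> (q1 \<union> s1))"
    using v(2) vC by (simp_all add: B_def C_def Un_ac)
  note sqB = square_cells[OF merge8(6) neB vB]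
  note zz = z z' sqB(1-4)[simplified expand8]
  \<comment> \<open>Each cell keeps only its three neighbours in the cube. The constants 1 and 2 are
    the unsafe edges from \<open>p2\<close> to \<open>r2\<close> and from \<open>q2\<close> to
    \<open>s2\<close>.\<close>
  have f: "2 * k + min 2 (links U p1 p2 + links U p1 q1) \<le> links E p1 p2 + links E p1 q1 + links E p1 r1 + 1"
     "2 * k + min 2 (links U p1 p2 + links U p2 q2 + 1) \<le> links E p1 p2 + links E p2 q2 + links E p2 r2 + 1"
     "2 * k + min 2 (links U q1 q2 + links U p1 q1) \<le> links E q1 q2 + links E p1 q1 + links E q1 s1 + 1"
     "2 * k + min 2 (links U q1 q2 + links U p2 q2 + 2) \<le> links E q1 q2 + links E p2 q2 + links E q2 s2 + 1"
     "2 * k + min 2 (links U r1 r2 + links U r1 s1) \<le> links E r1 r2 + links E r1 s1 + links E p1 r1 + 1"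
     "2 * k + min 2 (links U r1 r2 + links U r2 s2 + 1) \<le> links E r1 r2 + links E r2 s2 + links E p2 r2 + 1"
     "2 * k + min 2 (links U s1 s2 + links U r1 s1) \<le> links E s1 s2 + links E r1 s1 + links E q1 s1 + 1"
     "2 * k + min 2 (links U s1 s2 + links U r2 s2 + 2) \<le> links E s1 s2 + links E r2 s2 + links E q2 s2 + 1"
    using flex_links[of p1 "p2 \<union> q1 \<union> q2 \<union> r1 \<union> r2 \<union> s1 \<union> s2"]
      flex_links[of p2 "p1 \<union> q1 \<union> q2 \<union> r1 \<union> r2 \<union> s1 \<union> s2"]
      flex_links[of q1 "p1 \<union> p2 \<union> q2 \<union> r1 \<union> r2 \<union> s1 \<union> s2"]
      flex_links[of q2 "p1 \<union> p2 \<union> q1 \<union> r1 \<union> r2 \<union> s1 \<union> s2"]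
      flex_links[of r1 "p1 \<union> p2 \<union> q1 \<union> q2 \<union> r2 \<union> s1 \<union> s2"]
      flex_links[of r2 "p1 \<union> p2 \<union> q1 \<union> q2 \<union> r1 \<union> s1 \<union> s2"]
      flex_links[of s1 "p1 \<union> p2 \<union> q1 \<union> q2 \<union> r1 \<union> r2 \<union> s2"]
      flex_links[of s2 "p1 \<union> p2 \<union> q1 \<union> q2 \<union> r1 \<union> r2 \<union> s1"]
    ne8 disj8 union8 by (simp_all add: expand8 zz u Un_ac)
  have Bs: "links E p1 q1 + links E p2 q2 + links E r1 s1 + links E r2 s2 = 2 * k + 1"
     "3 \<le> links U p1 q1 + links U p2 q2 + links U r1 s1 + links U r2 s2"
    using sq(6,10) by (simp_all add: expand8 zz)
  have Cs: "links E p1 p2 + links E q1 q2 + links E r1 r2 + links E s1 s2 = 2 * k + 1"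
    using sqC(6) by (simp add: expand8 zz)
  define d1 where "d1 = links E p1 p2 + links E p1 q1 + links E p1 r1"
  define d2 where "d2 = links E p1 p2 + links E p2 q2 + links E p2 r2"
  define d3 where "d3 = links E q1 q2 + links E p1 q1 + links E q1 s1"
  define d4 where "d4 = links E q1 q2 + links E p2 q2 + links E q2 s2"
  define d5 where "d5 = links E r1 r2 + links E r1 s1 + links E p1 r1"
  define d6 where "d6 = links E r1 r2 + links E r2 s2 + links E p2 r2"
  define d7 where "d7 = links E s1 s2 + links E r1 s1 + links E q1 s1"
  define d8 where "d8 = links E s1 s2 + links E r2 s2 + links E q2 s2"
  note d = d1_def d2_def d3_def d4_def d5_def d6_def d7_def d8_def
  note f' = f[folded d]
  \<comment> \<open>The eight cut sizes sum to twice the size of the three disjoint cuts; this makes all bounds tight.\<close>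
  have "d1 + d2 + d3 + d4 + d5 + d6 + d7 + d8 = 12 * k + 6"
    using Bs(1) Cs e(1,2) unfolding d by linarith
  moreover have "2 * k \<le> d1 + 1" "2 * k + 1 \<le> d2 + 1" "2 * k \<le> d3 + 1" "2 * k + 2 \<le> d4 + 1"
    "2 * k \<le> d5 + 1" "2 * k + 1 \<le> d6 + 1" "2 * k \<le> d7 + 1" "2 * k + 2 \<le> d8 + 1"
    subgoal using f'(1) by linarith
    subgoal using f'(2) by linarith
    subgoal using f'(3) by linarith
    subgoal using f'(4) by linarith
    subgoal using f'(5) by linarith
    subgoal using f'(6) by linarith
    subgoal using f'(7) by linarith
    subgoal using f'(8) by linarith
    done
  ultimately have up: "d1 + 1 \<le> 2 * k" "d2 \<le> 2 * k" "d5 + 1 \<le> 2 * k" "d6 \<le> 2 * k"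
    using k_ge_2 by linarith+
  \<comment> \<open>Tightness at the four cells of \<open>B\<close> excludes further unsafe edges
    there, hence any in \<delta>(B).\<close>
  have "links U p1 q1 = 0" "links U p2 q2 = 0" "links U r1 s1 = 0" "links U r2 s2 = 0"
    subgoal using f'(1) up(1) by linarith
    subgoal using f'(2) up(2) by linarith
    subgoal using f'(5) up(3) by linarith
    subgoal using f'(6) up(4) by linarith
    done
  then show False using Bs(2) by simp
qed

end

section \<open>From eight cells back to sets\<close>

lemma cells_refine:
  assumes "cells [P, Q, R, S]" "D \<subseteq> V"
  shows "cells [P \<inter> D, P - D, Q \<inter> D, Q - D, R \<inter> D, R - D, S \<inter> D, S - D]"
    and "D = Q \<inter> D \<union> (P \<inter> D \<union> R \<inter> D \<union> S \<inter> D)"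
    and "D = P \<inter> D \<union> Q \<inter> D \<union> (R \<inter> D \<union> S \<inter> D)"
    and "D - Q = P \<inter> D \<union> R \<inter> D \<union> S \<inter> D"
  using assms by (auto simp: cells_def disjnt_iff)

lemma lowered_of_corner:
  assumes c: "cells [P, Q, R, S]" "P \<noteq> {}" "Q \<noteq> {}" "R \<noteq> {}" "S \<noteq> {}"
    and v: "violated (P \<union> Q)" "violated (P \<union> R)"
    and small: "links E P Q = k" "links E P R = k"
    and low: "lowered_by Q C"
  shows "lowered_by (P \<union> Q) C"
proof -
  have sub: "Q \<subseteq> V" "C \<subseteq> V" "P \<union> Q \<subseteq> V" using lowered_by_subset[OF low] v by (auto simp: violated_def)
  obtain D where D: "D \<in> {C, V - C}" "links E (Q \<inter> D) (D - Q) = k" "links U (Q \<inter> D) (D - Q) = 1"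
    using low by (auto simp: lowered_by_def)
  then have "D \<subseteq> V" "lowered_by Q D" using low sub lowered_by_Compl_right by auto
  note r = cells_refine[OF c(1) this(1)]
  have "lowered_by (P \<union> Q) D"
    using lowered_of_corner8[OF r(1)] r(2) c(2-5) v small \<open>lowered_by Q D\<close> D(2,3)
    by (simp add: r(4) Int_Diff_Un flip: r(2))
  then show ?thesis using D(1) sub lowered_by_Compl_right by auto
qed

lemma lowering_of_corner:
  assumes c: "cells [P, Q, R, S]" "P \<noteq> {}" "Q \<noteq> {}" "R \<noteq> {}" "S \<noteq> {}"
    and v: "violated (P \<union> Q)" "violated (P \<union> R)"
    and low: "lowered_by C Q"
  shows "lowered_by C (P \<union> Q) \<or> lowered_by C (P \<union> R)"
proof -
  have "C \<subseteq> V" using lowered_by_subset[OF low] by simp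
  note r = cells_refine[OF c(1) this]
  show ?thesis
    using lowering_of_corner8[OF r(1)] c(2-5) v low
    by (simp add: Int_Diff_Un flip: r(2))
qed

lemma lowering_not_lowered:
  assumes "lowered_by A B" "lowered_by C A"
  shows False
proof -
  have sub: "A \<subseteq> V" "B \<subseteq> V" "C \<subseteq> V" using assms lowered_by_subset by auto
  obtain B' where B': "B' \<in> {B, V - B}" "links E (A \<inter> B') (B' - A) = k" "links U (A \<inter> B') (B' - A) = 1"
    using assms(1) by (auto simp: lowered_by_def)
  then have "B' \<subseteq> V" "lowered_by A B'" using sub assms(1) lowered_by_Compl_right by auto
  \<comment> \<open>By the square of \<open>A\<close> and \<open>C\<close>, one side of
    \<open>C\<close> contains only \<open>k\<close> edges of \<delta>(A); complementing
    \<open>C\<close> if necessary makes it the inside.\<close>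
  have "\<exists>C'\<in>{C, V - C}. links E (A \<inter> C') (C' - A) = k"
  proof -
    have c: "cells [A \<inter> C, A - C, C - A, V - (A \<union> C)]" "A = A \<inter> C \<union> (A - C)" "C = A \<inter> C \<union> (C - A)"
      using cells4[OF sub(1,3)] by auto
    have "violated A" "violated C" "A \<inter> C \<noteq> {}" "A - C \<noteq> {}" "C - A \<noteq> {}" "V - (A \<union> C) \<noteq> {}"
      using assms(2) by (auto simp: lowered_by_def crosses_def)
    then have "links E (A \<inter> C) (C - A) = k \<or> links E (A - C) (V - (A \<union> C)) = k"
      using square_cells(11)[OF c(1), folded c(2,3)] by blast
    moreover have "A \<inter> (V - C) = A - C" "V - C - A = V - (A \<union> C)" using sub by auto
    ultimately show ?thesis by auto
  qed
  then obtain C' where C': "C' \<in> {C, V - C}" "links E (A \<inter> C') (C' - A) = k" by blast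
  then have "C' \<subseteq> V" "lowered_by C' A" using sub assms(2) lowered_by_Compl_left by auto
  define P Q R S where "P = A \<inter> B'" and "Q = A - B'" and "R = B' - A" and "S = V - (A \<union> B')"
  have c: "cells [P, Q, R, S]" unfolding P_def Q_def R_def S_def
    using cells4[OF sub(1) \<open>B' \<subseteq> V\<close>] .
  have A: "A = P \<union> Q" and B: "B' = P \<union> R" by (auto simp: P_def Q_def R_def)
  note r = cells_refine[OF c \<open>C' \<subseteq> V\<close>]
  have "A \<inter> C' = P \<inter> C' \<union> Q \<inter> C'" "C' - A = R \<inter> C' \<union> S \<inter> C'"
    using \<open>C' \<subseteq> V\<close> by (auto simp: P_def Q_def R_def S_def)
  then have partC: "links E (P \<inter> C' \<union> Q \<inter> C') (R \<inter> C' \<union> S \<inter> C') = k"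
    using C'(2) by simp
  show False
  proof (rule lowering_not_lowered8[OF r(1) _ _ r(3) \<open>lowered_by A B'\<close> \<open>lowered_by C' A\<close> _ _ partC])
    show "A = P \<inter> C' \<union> (P - C') \<union> (Q \<inter> C' \<union> (Q - C'))"
      "B' = P \<inter> C' \<union> (P - C') \<union> (R \<inter> C' \<union> (R - C'))"
      unfolding Int_Diff_Un by (fact A, fact B)
    show "links E (P \<inter> C' \<union> (P - C')) (R \<inter> C' \<union> (R - C')) = k"
      "links U (P \<inter> C' \<union> (P - C')) (R \<inter> C' \<union> (R - C')) = 1"
      unfolding Int_Diff_Un using B'(2,3)[folded P_def R_def] by auto
  qed
qed

section \<open>Uncrossing within each of the two families\<close>

text \<open>One argument for both families: \<open>T\<close> will be "is lowered" or "lowers some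
  set". A crossing pair uncrosses to the two neighbours of its small corner; \<open>low\<close>
  makes them violated and \<open>closed\<close> keeps them outside \<open>T\<close>.\<close>

lemma uncrossable_avoiding:
  fixes T :: "'v set \<Rightarrow> bool"
  assumes compl: "\<And>S. S \<subseteq> V \<Longrightarrow> T (V - S) \<longleftrightarrow> T S"
    and low: "\<And>A B. lowered_by A B \<Longrightarrow> T A \<or> T B"
    and closed: "\<And>P Q R S. \<lbrakk>cells [P, Q, R, S]; P \<noteq> {}; Q \<noteq> {}; R \<noteq> {}; S \<noteq> {};
      violated (P \<union> Q); violated (P \<union> R); links E P Q = k; links E P R = k; T Q\<rbrakk> \<Longrightarrow> T (P \<union> Q) \<or> T (P \<union> R)"
  shows "uncrossable {S. violated S \<and> \<not> T S}"
proof -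
  define H where "H = {S. violated S \<and> \<not> T S}"
  have H_sub: "S \<subseteq> V" if "S \<in> H" for S using that by (auto simp: H_def violated_def)
  have H_compl: "V - S \<in> H \<longleftrightarrow> S \<in> H" if "S \<subseteq> V" for S
    using that compl violated_Compl by (auto simp: H_def)
  have corner: "Q \<in> H"
    if c: "cells [P, Q, R, S]" "P \<noteq> {}" "Q \<noteq> {}" "R \<noteq> {}" "S \<noteq> {}"
      and H: "P \<union> Q \<in> H" "P \<union> R \<in> H" and small: "links E P Q = k" "links E P R = k" for P Q R S
  proof -
    have v: "violated (P \<union> Q)" "violated (P \<union> R)" and T: "\<not> T (P \<union> Q)" "\<not> T (P \<union> R)"
      using H by (auto simp: H_def)
    note sq = square_cells[OF c v] small_square[OF c v small]
    have dj: "disjnt P Q" "disjnt P R" "disjnt P S" "disjnt Q R" "disjnt Q S" "disjnt R S"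
      "disjnt R Q" "disjnt S Q" "disjnt Q P" "disjnt S R" "disjnt S P" "disjnt R P"
      and V: "Q \<union> (P \<union> R \<union> S) = V"
      using c(1) by (auto simp: cells_def disjnt_sym)
    have l: "links F Q (P \<union> R \<union> S) = links F P Q + links F Q R + links F Q S" if "F = E \<or> F = U" for F
      using that dj by (simp add: links_Un_right links_commute[of F Q P])
    \<comment> \<open>The cut of \<open>Q\<close> has \<open>k + (k + 1)\<close> edges, so only its
      unsafe count can fail. Then \<delta>(A) has exactly three unsafe edges, one of them between
      \<open>P\<close> and \<open>R\<close>, so \<open>P \<union> Q\<close> is lowered by
      \<open>P \<union> R\<close>.\<close>
    have "violated Q"
    proof (rule ccontr)
      assume "\<not> violated Q"
      then have "links U P Q + links U Q S < 3"
        using violated_iff(1)[OF V] dj l sq small by auto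
      then have "links U P R = 1" "card (cut U ends (P \<union> Q)) = 3" using sq(7,9,14) by linarith+
      then have "lowered_by (P \<union> Q) (P \<union> R)"
        unfolding lowered_by_iff[OF c(1) refl refl] using v c small by blast
      then show False using low T by blast
    qed
    moreover have "\<not> T Q" using closed[OF c v small] T by blast
    ultimately show ?thesis by (simp add: H_def)
  qed
  have "(A \<union> B \<in> H \<and> A \<inter> B \<in> H) \<or> (A - B \<in> H \<and> B - A \<in> H)" if AB: "A \<in> H" "B \<in> H" for A B
  proof (cases "crosses A B")
    case False
    have sub: "A \<subseteq> V" "B \<subseteq> V" using AB H_sub by auto
    have "A \<inter> B = {} \<or> A \<subseteq> B \<or> B \<subseteq> A \<or> A \<union> B = V"
      using False sub by (auto simp: crosses_def)
    \<comment> \<open>The last alternative is \<open>A \<union> B = V\<close>, settled by closure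
      under complement.\<close>
    then consider "A - B = A" "B - A = B" | "A \<union> B = B" "A \<inter> B = A" | "A \<union> B = A" "A \<inter> B = B"
      | "A - B = V - B" "B - A = V - A"
      using sub by blast
    then show ?thesis using AB H_compl sub by cases simp_all
  next
    case True
    define P Q R S where "P = A \<inter> B" and "Q = A - B" and "R = B - A" and "S = V - (A \<union> B)"
    have sub: "A \<subseteq> V" "B \<subseteq> V" using AB H_sub by auto
    have c: "cells [P, Q, R, S]"
      using cells4[OF sub] by (simp add: P_def Q_def R_def S_def)
    \<comment> \<open>\<open>corner\<close> yields the second cell of a list whose first cell is the
      small corner; these orders cover every small corner with both its neighbours.\<close>
    then have c': "cells [P, R, Q, S]" "cells [R, S, P, Q]" "cells [R, P, S, Q]" "cells [Q, P, S, R]"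
      "cells [Q, S, P, R]" "cells [S, R, Q, P]" "cells [S, Q, R, P]"
      by (auto simp: cells_def disjnt_sym)
    have ne: "P \<noteq> {}" "Q \<noteq> {}" "R \<noteq> {}" "S \<noteq> {}"
      using True by (auto simp: crosses_def P_def Q_def R_def S_def)
    have u: "P \<union> Q = A" "P \<union> R = B" "R \<union> S = V - A" "Q \<union> S = V - B" "V - S = A \<union> B"
      using sub by (auto simp: P_def Q_def R_def S_def)
    have H: "P \<union> Q \<in> H" "P \<union> R \<in> H" "R \<union> S \<in> H" "Q \<union> S \<in> H"
      unfolding u using AB H_compl sub by auto
    then have H': "Q \<union> P \<in> H" "R \<union> P \<in> H" "S \<union> R \<in> H" "S \<union> Q \<in> H" by (simp_all add: Un_commute)
    have S: "S \<in> H \<longleftrightarrow> A \<union> B \<in> H" using H_compl[of S] unfolding u by (auto simp: S_def)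
    have v: "violated (P \<union> Q)" "violated (P \<union> R)" using H by (auto simp: H_def)
    have "links E P R = k \<and> links E P Q = k \<or> links E P R = k \<and> links E R S = k \<or>
         links E Q S = k \<and> links E P Q = k \<or> links E Q S = k \<and> links E R S = k"
      using square_cells(11)[OF c ne v] by blast
    then have "Q \<in> H \<and> R \<in> H \<or> P \<in> H \<and> S \<in> H"
    proof (elim disjE conjE)
      assume "links E P R = k" "links E P Q = k"
      then show ?thesis using corner[OF c] corner[OF c'(1)] ne H H' by (simp add: links_commute)
    next
      assume "links E P R = k" "links E R S = k"
      then show ?thesis using corner[OF c'(2)] corner[OF c'(3)] ne H H' by (simp add: links_commute)
    next
      assume "links E Q S = k" "links E P Q = k"
      then show ?thesis using corner[OF c'(4)] corner[OF c'(5)] ne H H' by (simp add: links_commute)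
    next
      assume "links E Q S = k" "links E R S = k"
      then show ?thesis using corner[OF c'(6)] corner[OF c'(7)] ne H H' by (simp add: links_commute)
    qed
    then show ?thesis unfolding S unfolding P_def Q_def R_def by blast
  qed
  then show ?thesis unfolding uncrossable_def H_def[symmetric] by blast
qed

lemma violated_decomposition:
  "\<exists>F1 F2. {S. violated S} = F1 \<union> F2 \<and> uncrossable F1 \<and> uncrossable F2"
proof (intro exI conjI)
  let ?D = "\<lambda>S. \<exists>C. lowered_by S C" and ?U = "\<lambda>S. \<exists>C. lowered_by C S"
  show "{S. violated S} = {S. violated S \<and> \<not> ?D S} \<union> {S. violated S \<and> \<not> ?U S}"
    using lowering_not_lowered by blast
  show "uncrossable {S. violated S \<and> \<not> ?D S}"
  proof (rule uncrossable_avoiding)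
    show "?D (V - S) \<longleftrightarrow> ?D S" if "S \<subseteq> V" for S
      using that by (simp add: lowered_by_Compl_left)
  next
    show "?D A \<or> ?D B" if "lowered_by A B" for A B using that by blast
  qed (use lowered_of_corner in blast)
  show "uncrossable {S. violated S \<and> \<not> ?U S}"
  proof (rule uncrossable_avoiding)
    show "?U (V - S) \<longleftrightarrow> ?U S" if "S \<subseteq> V" for S
      using that by (simp add: lowered_by_Compl_right)
  next
    show "?U A \<or> ?U B" if "lowered_by A B" for A B using that by blast
  qed (use lowering_of_corner in blast)
qed

end

section \<open>From flex-connectivity to cut sizes\<close>

text \<open>Without cut edges no walk starting in \<open>S\<close> can leave it.\<close>

lemma cut_disconnects:
  assumes "connected_graph V E ends" "S \<subseteq> V" "S \<noteq> {}" "S \<noteq> V"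
    and "\<And>e. e \<in> E \<Longrightarrow> card (ends e) = 2"
  shows "cut E ends S \<noteq> {}"
proof
  assume empty: "cut E ends S = {}"
  obtain u v where uv: "u \<in> S" "v \<in> V" "v \<notin> S" using assms(2-4) by blast
  then have "(u, v) \<in> (adjacency E ends)\<^sup>*"
    using assms(1,2) by (auto simp: connected_graph_def)
  then have "v \<in> S"
  proof (induction rule: rtrancl_induct)
    case (step y z)
    then obtain e where e: "e \<in> E" "ends e = {y, z}" by (auto simp: adjacency_def)
    show ?case
    proof (rule ccontr)
      assume "z \<notin> S"
      then have "ends e \<inter> S = {y}" using e step by auto
      then show False using empty e by (auto simp: cut_def)
    qed
  qed (rule uv)
  then show False using uv by blast
qed

text \<open>Deleting as many unsafe cut edges as allowed, at most \<open>q\<close>, would otherwise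
  leave fewer than \<open>p\<close> cut edges, whose removal disconnects the graph.\<close>

lemma flex_connected_cut:
  assumes "multigraph V E ends" "U \<subseteq> E" "flex_connected p q V E ends U"
    and "S \<subseteq> V" "S \<noteq> {}" "S \<noteq> V"
  shows "p + min q (card (cut U ends S)) \<le> card (cut E ends S)"
proof (rule ccontr)
  interpret multigraph V E ends by fact
  have "finite U" using assms(2) finite_E finite_subset by blast
  then have fin: "finite (cut U ends S)" "finite (cut E ends S)"
    using finite_E by (simp_all add: cut_def)
  have sub: "cut U ends S \<subseteq> cut E ends S" using assms(2) by (auto simp: cut_def)
  assume less: "\<not> ?thesis"
  obtain F where F: "F \<subseteq> cut U ends S" "card F = min q (card (cut U ends S))"
    by (meson min.cobounded2 obtain_subset_with_card_n)
  define X where "X = cut E ends S - F"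
  have "card X = card (cut E ends S) - card F"
    unfolding X_def using F(1) sub fin by (intro card_Diff_subset) (auto intro: finite_subset)
  moreover have "card F \<le> card (cut E ends S)"
    using F(1) sub fin by (intro card_mono) auto
  ultimately have "card X < p" using less F(2) by linarith
  have "F \<subseteq> U" "card F \<le> q" using F by (auto simp: cut_def)
  then have "edge_connected p V (E - F) ends" using assms(3) by (auto simp: flex_connected_def)
  moreover have "X \<subseteq> E - F" by (auto simp: X_def cut_def)
  ultimately have "connected_graph V (E - F - X) ends"
    using \<open>card X < p\<close> by (auto simp: edge_connected_def)
  then have "cut (E - F - X) ends S \<noteq> {}"
    by (rule cut_disconnects) (use assms(4-6) card_ends in auto)
  then show False by (auto simp: X_def cut_def)
qed

theorem theorem2:
  fixes p :: nat and V :: "'v set" and E U :: "'e set" and ends :: "'e \<Rightarrow> 'v set"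
  assumes "p \<ge> 3" and "odd p"
    and "multigraph V E ends"
    and "U \<subseteq> E"
    and "flex_connected p 2 V E ends U"
  shows "\<exists>F1 F2. violated_sets p V E ends U = F1 \<union> F2 \<and> uncrossable F1 \<and> uncrossable F2"
proof -
  obtain l where l: "p = 2 * l + 1" using assms(2) by (rule oddE)
  interpret multigraph V E ends by fact
  \<comment> \<open>\<open>k = l + 1\<close> turns \<open>p = 2 * l + 1\<close> into
    \<open>2 * k - 1\<close>, and \<open>p \<ge> 3\<close> gives \<open>2 \<le> k\<close>.\<close>
  interpret odd_flex V E ends U "l + 1"
  proof
    show "2 * (l + 1) + min 2 (card (cut U ends S)) \<le> card (cut E ends S) + 1"
      if "S \<subseteq> V" "S \<noteq> {}" "S \<noteq> V" for S
      using flex_connected_cut[OF assms(3-5) that] l by simp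
  qed (use assms(1,4) l in auto)
  have "cut E ends S \<inter> U = cut U ends S" for S using assms(4) by (auto simp: cut_def)
  then have "violated_sets p V E ends U = {S. violated S}"
    unfolding violated_sets_def violated_def l by simp
  then show ?thesis using violated_decomposition by simp
qed

end
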